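(* Let $\mathcal{P}=\{\bm x\in\mathbb{R}^K:\bm S\bm x\le\bm t\}$ with $\bm S\in\mathbb{R}^{J\times K}$ and $\bm t\in\mathbb{R}^J$ be a polytope that is compact and full-dimensional. Then $\mathrm{Vol}(\mathcal{E}_{\mathrm{sdp}})\le\mathrm{Vol}(\mathcal{E}_{\mathrm{smvie}})$, where $\mathcal{E}_{\mathrm{sdp}}$ is the ellipsoid obtained from the semidefinite program described in the context and $\mathcal{E}_{\mathrm{smvie}}$ is the maximum volume ellipsoid inscribed in $\mathcal{P}$ scaled around its center by the factor $K$.
   Context: $\mathbb{S}^K$, $\mathbb{S}^K_{++}$ are the real symmetric and symmetric positive definite $K\times K$ matrices; $\mathbb{R}^{J\times J}_+$ is the set of entrywise nonnegative matrices; $\mathbb{I}$ is the identity; $\|\cdot\|$ is the Euclidean norm; $\bm S_{j:}\in\mathbb{R}^K$ is the transpose of the $j$-th row of $\bm S$; $\bm P\succeq\bm Q$ (equivalently $\bm Q\preceq\bm P$) means $\bm P-\bm Q$ is symmetric positive semidefinite. Full-dimensional means having nonempty interior. For $\bm A\in\mathbb{S}^K_{++}$, $\bm b\in\mathbb{R}^K$, let $\mathcal{E}(\bm A,\bm b)=\{\bm x\in\mathbb{R}^K:\|\bm A\bm x+\bm b\|^2\le1\}$ and (dropping a dimension-dependent constant) $\mathrm{Vol}(\mathcal{E}(\bm A,\bm b))=1/\det(\bm A)$. The function $-\log\det(\cdot)$ is $+\infty$ at symmetric matrices that are not positive definite, so positive definiteness is implicit in the optimization problems defining $\mathcal{E}_{\mathrm{sdp}}$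 and $\mathcal{E}_{\mathrm{smvie}}$. $\mathcal{E}_{\mathrm{sdp}}=\mathcal{E}(\bm A,\bm b)$, where $(\bm A,\bm b,\bm N,\bm F,\bm g,h)$ is an optimal solution of: minimize $-\log\det(\bm A)$ over $\bm A\in\mathbb{S}^K$, $\bm b\in\mathbb{R}^K$, $\bm N\in\mathbb{R}_+^{J\times J}$, $\bm F\in\mathbb{S}^K$, $\bm g\in\mathbb{R}^K$, $h\in\mathbb{R}$ subject to $$\begin{bmatrix}\bm F&\bm g\\ \bm g^\top&h-1\end{bmatrix}\preceq-\begin{bmatrix}-\bm S^\top\\ \bm t^\top\end{bmatrix}\bm N\begin{bmatrix}-\bm S&\bm t\end{bmatrix},\qquad\begin{bmatrix}\bm F&\bm g&\bm A\\ \bm g^\top&h&\bm b^\top\\ \bm A&\bm b&\mathbb{I}\end{bmatrix}\succeq\bm 0.$$ $\mathcal{E}_{\mathrm{smvie}}=\{K\bm B\bm u+\bm d:\bm u\in\mathbb{R}^K,\|\bm u\|\le1\}$, where $(\bm B,\bm d)$ is an optimal solution of: maximize $\log\det(\bm B)$ over $\bm B\in\mathbb{S}^K$, $\bm d\in\mathbb{R}^K$ subject to $\|\bm B\bm S_{j:}\|+\bm S_{j:}^\top\bm d\le t_j$ for all $j=1,\dots,J$ (so that $\{\bm B\bm u+\bm d:\|\bm u\|\le1\}$ is the maximum volume ellipsoid contained in $\mathcal{P}$). With the volume convention $\mathrm{Vol}(\mathcal{E}(\bm A,\bm b))=1/\det(\bm A)$, one has $\mathrm{Vol}(\mathcal{E}_{\mathrm{smvie}})=\det(K\bm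 B)$. *)

theory Defs
  imports "HOL-Analysis.Analysis"
begin

definition symmetric_matrix :: "real^'n^'n \<Rightarrow> bool" where
  "symmetric_matrix A \<longleftrightarrow> transpose A = A"

definition psd :: "real^'n^'n \<Rightarrow> bool" where
  "psd A \<longleftrightarrow> symmetric_matrix A \<and> (\<forall>x. 0 \<le> x \<bullet> (A *v x))"

definition pos_def :: "real^'n^'n \<Rightarrow> bool" where
  "pos_def A \<longleftrightarrow> symmetric_matrix A \<and> (\<forall>x. x \<noteq> 0 \<longrightarrow> 0 < x \<bullet> (A *v x))"

text \<open>
  The relation \<open>P \<preceq> Q\<close> includes the symmetry of \<open>Q - P\<close>; neither side is assumed symmetric.
\<close>

definition loewner_le :: "real^'n^'n \<Rightarrow> real^'n^'n \<Rightarrow> bool" (infix "\<preceq>" 50) where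
  "P \<preceq> Q \<longleftrightarrow> psd (Q - P)"

definition log_det :: "real^'n^'n \<Rightarrow> ereal" where
  "log_det A = (if pos_def A then ereal (ln (det A)) else - \<infinity>)"

definition hcat :: "real^'a^'m \<Rightarrow> real^'b^'m \<Rightarrow> real^('a + 'b)^'m" where
  "hcat A B = (\<chi> i j. case j of Inl k \<Rightarrow> A $ i $ k | Inr k \<Rightarrow> B $ i $ k)"

definition vcat :: "real^'n^'a \<Rightarrow> real^'n^'b \<Rightarrow> real^'n^('a + 'b)" where
  "vcat A B = (\<chi> i. case i of Inl k \<Rightarrow> A $ k | Inr k \<Rightarrow> B $ k)"

definition ellipsoid :: "real^'k^'k \<Rightarrow> real^'k \<Rightarrow> (real^'k) set" where
  "ellipsoid A b = {x. (norm (A *v x + b))\<^sup>2 \<le> 1}"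

text \<open>
  The volume of an ellipsoid up to a dimension-dependent constant. The value does not depend on the
  representation \<open>E = ellipsoid A b\<close>; see \<open>vol_ellipsoid\<close> and \<open>vol_scaled_mvie\<close> below.
\<close>

definition vol :: "(real^'k) set \<Rightarrow> real" where
  "vol E = (THE v. \<exists>A b. pos_def A \<and> E = ellipsoid A b \<and> v = 1 / det A)"

text \<open>
  In the block matrices below, \<open>mat h :: real^1^1\<close> is the scalar \<open>h\<close>. The matrix \<open>N\<close> is
  entrywise nonnegative, but not required to be symmetric.
\<close>

definition sdp_feasible ::
  "real^'k^'j \<Rightarrow> real^'j \<Rightarrow> real^'k^'k \<Rightarrow> real^'k \<Rightarrow> real^'j^'j \<Rightarrow> real^'k^'k \<Rightarrow> real^'k \<Rightarrow> real \<Rightarrow> bool"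
where
  "sdp_feasible S t A b N F g h \<longleftrightarrow>
     symmetric_matrix A \<and> symmetric_matrix F \<and> (\<forall>i j. 0 \<le> N $ i $ j) \<and>
     vcat (hcat F                               (columnvector g :: real^1^'k))
          (hcat (rowvector g :: real^'k^1)      (mat (h - 1) :: real^1^1))
       \<preceq> - (vcat (- transpose S) (rowvector t :: real^'j^1) ** N **
             hcat (- S) (columnvector t :: real^1^'j)) \<and>
     0 \<preceq>
     vcat (hcat F                               (hcat (columnvector g :: real^1^'k) A))
    (vcat (hcat (rowvector g :: real^'k^1)      (hcat (mat h :: real^1^1) (rowvector b :: real^'k^1)))
          (hcat A                               (hcat (columnvector b :: real^1^'k) (mat 1))))"

definition sdp_optimal ::
  "real^'k^'j \<Rightarrow> real^'j \<Rightarrow> real^'k^'k \<Rightarrow> real^'k \<Rightarrow> real^'j^'j \<Rightarrow> real^'k^'k \<Rightarrow> real^'k \<Rightarrow> real \<Rightarrow> bool"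
where
  "sdp_optimal S t A b N F g h \<longleftrightarrow>
     sdp_feasible S t A b N F g h \<and>
     (\<forall>A' b' N' F' g' h'. sdp_feasible S t A' b' N' F' g' h' \<longrightarrow> - log_det A \<le> - log_det A')"

definition mvie_feasible ::
  "real^'k^'j \<Rightarrow> real^'j \<Rightarrow> real^'k^'k \<Rightarrow> real^'k \<Rightarrow> bool"
where
  "mvie_feasible S t B d \<longleftrightarrow>
     symmetric_matrix B \<and> (\<forall>j. norm (B *v row j S) + row j S \<bullet> d \<le> t $ j)"

definition mvie_optimal ::
  "real^'k^'j \<Rightarrow> real^'j \<Rightarrow> real^'k^'k \<Rightarrow> real^'k \<Rightarrow> bool"
where
  "mvie_optimal S t B d \<longleftrightarrow>
     mvie_feasible S t B d \<and>
     (\<forall>B' d'. mvie_feasible S t B' d' \<longrightarrow> log_det B' \<le> log_det B)"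

definition scaled_mvie :: "real^'k^'k \<Rightarrow> real^'k \<Rightarrow> (real^'k) set" where
  "scaled_mvie B d = {real CARD('k) *\<^sub>R (B *v u) + d | u. norm u \<le> 1}"


subsection \<open>The volume convention\<close>

lemma pos_def_det_pos:
  fixes A :: "real^'n^'n"
  assumes "pos_def A"
  shows "0 < det A"
proof -
  define M where "M s = (1 - s) *\<^sub>R mat 1 + s *\<^sub>R A" for s :: real
  have Mv: "M s *v x = (1 - s) *\<^sub>R x + s *\<^sub>R (A *v x)" for s x
    by (simp add: M_def matrix_vector_mult_add_rdistrib flip: scaleR_matrix_vector_assoc)
  have nz: "det (M s) \<noteq> 0" if s: "s \<in> {0..1}" for s
  proof -
    have "x = 0" if x: "M s *v x = 0" for x
    proof (rule ccontr)
      assume "x \<noteq> 0"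
      then have xx: "0 < x \<bullet> x" and xA: "0 < x \<bullet> (A *v x)"
        using assms by (auto simp: pos_def_def)
      have "x \<bullet> (M s *v x) = (1 - s) * (x \<bullet> x) + s * (x \<bullet> (A *v x))"
        by (simp add: Mv inner_add_right)
      moreover have "0 < (1 - s) * (x \<bullet> x) + s * (x \<bullet> (A *v x))"
      proof (cases "s = 0")
        case False
        then show ?thesis
          using s xx xA by (intro add_nonneg_pos mult_nonneg_nonneg mult_pos_pos) auto
      qed (use xx in auto)
      ultimately show False using x by simp
    qed
    then show ?thesis
      by (metis invertible_det_nz invertible_left_inverse matrix_left_invertible_ker)
  qed
  have cont: "continuous_on {0..1} (\<lambda>s. det (M s))"
    unfolding det_def M_def by (auto intro!: continuous_intros)
  have "det (M 0) = 1" "M 1 = A" by (simp_all add: M_def)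
  moreover have "0 < det (M 1)"
  proof (rule ccontr)
    assume "\<not> 0 < det (M 1)"
    then obtain s where "s \<in> {0..1}" "det (M s) = 0"
      using IVT2'[of "\<lambda>s. det (M s)" 1 0 0] cont \<open>det (M 0) = 1\<close> by auto
    with nz show False by blast
  qed
  ultimately show ?thesis by simp
qed

lemma pos_def_inverse:
  fixes A :: "real^'n^'n"
  assumes "pos_def A"
  obtains A' where "A ** A' = mat 1" "A' ** A = mat 1" "pos_def A'"
proof -
  have "det A \<noteq> 0" using pos_def_det_pos[OF assms] by simp
  then obtain A' where A': "A ** A' = mat 1" "A' ** A = mat 1"
    by (metis invertible_def invertible_det_nz)
  have sym: "transpose A = A" using assms by (simp add: pos_def_def symmetric_matrix_def)
  have "transpose A' ** A = mat 1"
    using arg_cong[OF A'(1), of transpose] by (simp add: matrix_transpose_mul sym)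
  then have "transpose A' = A'"
    by (metis A'(1) matrix_mul_assoc matrix_mul_lid matrix_mul_rid)
  moreover have "0 < x \<bullet> (A' *v x)" if "x \<noteq> 0" for x
  proof -
    have x: "A *v (A' *v x) = x" by (simp add: matrix_vector_mul_assoc A')
    with that have "A' *v x \<noteq> 0" by auto
    with assms have "0 < (A' *v x) \<bullet> (A *v (A' *v x))" by (simp add: pos_def_def)
    then show ?thesis by (simp add: x inner_commute)
  qed
  ultimately have "pos_def A'" by (simp add: pos_def_def symmetric_matrix_def)
  with A' that show thesis by blast
qed

lemma ellipsoid_iff: "x \<in> ellipsoid A b \<longleftrightarrow> norm (A *v x + b) \<le> 1"
  by (simp add: ellipsoid_def abs_square_le_1)

lemma ellipsoid_subset_norm_le:
  fixes A A' :: "real^'k^'k"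
  assumes "pos_def A" and sub: "ellipsoid A b \<subseteq> ellipsoid A' b'"
  shows "norm (A' *v x) \<le> norm (A *v x)"
proof -
  obtain A1 where A1: "A ** A1 = mat 1" "A1 ** A = mat 1" using assms(1) by (rule pos_def_inverse)
  have unit: "norm (A' *v y) \<le> 1" if y: "norm (A *v y) \<le> 1" for y
  proof -
    define z where "z = A1 *v (- b)"
    have z: "A *v z = - b" by (simp add: z_def matrix_vector_mul_assoc A1)
    have "z + y \<in> ellipsoid A b" "z - y \<in> ellipsoid A b"
      using y
      by (simp_all add: ellipsoid_iff z matrix_vector_right_distrib matrix_vector_mult_diff_distrib)
    then have "z + y \<in> ellipsoid A' b'" "z - y \<in> ellipsoid A' b'"
      using sub by auto
    then have "norm ((A' *v (z + y) + b') - (A' *v (z - y) + b')) \<le> 1 + 1"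
      unfolding ellipsoid_iff by (rule norm_triangle_le_diff[OF add_mono])
    also have "(A' *v (z + y) + b') - (A' *v (z - y) + b') = 2 *\<^sub>R (A' *v y)"
      by (simp add: matrix_vector_right_distrib matrix_vector_mult_diff_distrib scaleR_2)
    finally show ?thesis by simp
  qed
  show ?thesis
  proof (cases "x = 0")
    case False
    have "A *v x \<noteq> 0" using assms(1) False by (force simp: pos_def_def)
    then show ?thesis
      using unit[of "(1 / norm (A *v x)) *\<^sub>R x"]
      by (simp add: matrix_vector_mult_scaleR divide_simps)
  qed simp
qed

lemma ellipsoid_eq_det_eq:
  fixes A A' :: "real^'k^'k"
  assumes A: "pos_def A" and A': "pos_def A'" and eq: "ellipsoid A b = ellipsoid A' b'"
  shows "det A = det A'"
proof -
  have norm_eq: "norm (A' *v x) = norm (A *v x)" for x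
    using ellipsoid_subset_norm_le[OF A, of b A' b'] ellipsoid_subset_norm_le[OF A', of b' A b] eq
    by (intro antisym) auto
  obtain A1 where A1: "A ** A1 = mat 1" "pos_def A1" using A by (rule pos_def_inverse)
  have "norm ((A' ** A1) *v y) = norm y" for y
    by (simp add: norm_eq A1 flip: matrix_vector_mul_assoc) (simp add: matrix_vector_mul_assoc A1)
  then have "orthogonal_matrix (A' ** A1)"
    by (metis matrix_of_matrix_vector_mul matrix_vector_mul_linear orthogonal_transformation
        orthogonal_transformation_matrix)
  then have "det A' * det A1 = 1 \<or> det A' * det A1 = - 1"
    by (metis det_mul det_orthogonal_matrix)
  moreover have "0 < det A' * det A1" using A' A1 by (simp add: pos_def_det_pos)
  moreover have "det A * det A1 = 1" by (metis A1(1) det_I det_mul)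
  moreover have "0 < det A1" using A1 by (simp add: pos_def_det_pos)
  ultimately show ?thesis
    by (metis less_irrefl less_trans mult_right_cancel neg_less_0_iff_less zero_less_one)
qed

lemma vol_ellipsoid:
  fixes A :: "real^'k^'k"
  assumes "pos_def A"
  shows "vol (ellipsoid A b) = 1 / det A"
  unfolding vol_def by (rule the_equality) (use assms ellipsoid_eq_det_eq in \<open>metis+\<close>)

lemma vol_scaled_mvie:
  fixes B :: "real^'k^'k"
  assumes "pos_def B"
  shows "vol (scaled_mvie B d) = det (real CARD('k) *\<^sub>R B)"
proof -
  define C where "C = real CARD('k) *\<^sub>R B"
  have "pos_def C"
    using assms
    by (auto simp: C_def pos_def_def symmetric_matrix_def transpose_def vec_eq_iff
        simp flip: scaleR_matrix_vector_assoc)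
  then obtain A where A: "C ** A = mat 1" "A ** C = mat 1" "pos_def A" by (rule pos_def_inverse)
  have inv: "C *v (A *v x) = x" "A *v (C *v x) = x" for x
    by (simp_all add: matrix_vector_mul_assoc A)
  have "scaled_mvie B d = {C *v u + d | u. norm u \<le> 1}"
    by (simp add: scaled_mvie_def C_def scaleR_matrix_vector_assoc)
  also have "\<dots> = ellipsoid A (- (A *v d))"
  proof (intro set_eqI iffI)
    fix x assume "x \<in> ellipsoid A (- (A *v d))"
    then have "norm (A *v (x - d)) \<le> 1" by (simp add: ellipsoid_iff matrix_vector_mult_diff_distrib)
    moreover have "x = C *v (A *v (x - d)) + d" by (simp add: inv)
    ultimately show "x \<in> {C *v u + d | u. norm u \<le> 1}" by blast
  qed (auto simp: ellipsoid_iff matrix_vector_right_distrib inv)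
  finally have "vol (scaled_mvie B d) = 1 / det A" using A by (simp add: vol_ellipsoid)
  moreover have "det C * det A = 1" by (metis A(1) det_I det_mul)
  ultimately show ?thesis
    by (metis C_def mult.commute nonzero_eq_divide_eq mult_zero_left zero_neq_one)
qed

end

theory Submission
  imports Defs
begin

text \<open>
  Write \<open>s\<^sub>j\<close> for the rows of \<open>S\<close> and \<open>n\<^sub>j = \<parallel>B s\<^sub>j\<parallel>\<close>. First-order optimality of the inscribed
  ellipsoid, in the form of John's theorem, gives weights \<open>\<theta>\<^sub>j \<ge> 0\<close> with sum 1, supported on the
  contact constraints, such that \<open>\<Sum> (\<theta>\<^sub>j / n\<^sub>j) s\<^sub>j = 0\<close> and
  \<open>\<Sum> (\<theta>\<^sub>j / n\<^sub>j\<^sup>2) s\<^sub>j s\<^sub>j\<^sup>T = B\<^sup>-\<^sup>2 / K\<close>. With the unit vectors \<open>v\<^sub>j = B s\<^sub>j / n\<^sub>j\<close>, the matrix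
  \<open>N\<^sub>i\<^sub>j = \<theta>\<^sub>i \<theta>\<^sub>j (1 - v\<^sub>i \<bullet> v\<^sub>j) / (n\<^sub>i n\<^sub>j)\<close> is entrywise nonnegative, and these two identities yield
  exactly \<open>(z t - S x)\<^sup>T N (z t - S x) = z\<^sup>2 - \<parallel>A x + z b\<parallel>\<^sup>2\<close> for \<open>A = B\<^sup>-\<^sup>1 / K\<close> and \<open>b = - A d\<close>.
  Taking \<open>F\<close>, \<open>g\<close>, \<open>h\<close> to be the Gram blocks of \<open>[A b]\<close> therefore makes the scaled ellipsoid feasible
  for the semidefinite program, whose optimum can only have a larger \<open>det A\<close>.
\<close>

section \<open>Convex weights and the derivative of the determinant\<close>

text \<open>The weights belong to indices rather than to points, because different constraints may
  contribute the same point \<open>f i\<close>. One representative index is kept for each point, and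
  every other index, inside or outside \<open>I\<close>, gets weight 0.\<close>

lemma convex_hull_image_weights:
  fixes f :: "'i \<Rightarrow> 'a::real_vector"
  assumes "finite I" "x \<in> convex hull (f ` I)"
  obtains u where "\<And>i. 0 \<le> u i" "\<And>i. i \<notin> I \<Longrightarrow> u i = 0" "sum u I = 1"
    "(\<Sum>i\<in>I. u i *\<^sub>R f i) = x"
proof -
  obtain C where C: "C \<subseteq> I" "inj_on f C" "f ` I = f ` C"
    using subset_image_inj[of "f ` I" f I] by auto
  have "finite (f ` C)" using assms(1) C finite_subset by blast
  then obtain w where w: "\<forall>y\<in>f ` C. 0 \<le> w y" "sum w (f ` C) = 1"
      "(\<Sum>y\<in>f ` C. w y *\<^sub>R y) = x"
    using assms(2) unfolding C(3) by (auto simp: convex_hull_finite)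
  define u where "u i = (if i \<in> C then w (f i) else 0)" for i
  show thesis
  proof (rule that[of u])
    show "0 \<le> u i" for i using w(1) by (auto simp: u_def)
    show "u i = 0" if "i \<notin> I" for i using that C(1) by (auto simp: u_def)
    have "sum u I = sum u C"
      using assms(1) C(1) by (intro sum.mono_neutral_right) (auto simp: u_def)
    then show "sum u I = 1"
      using w(2) C(2) by (simp add: sum.reindex u_def)
    have "(\<Sum>i\<in>I. u i *\<^sub>R f i) = (\<Sum>i\<in>C. u i *\<^sub>R f i)"
      using assms(1) C(1) by (intro sum.mono_neutral_right) (auto simp: u_def)
    then show "(\<Sum>i\<in>I. u i *\<^sub>R f i) = x"
      using w(3) C(2) by (simp add: sum.reindex u_def)
  qed
qed

text \<open>In the Leibniz formula, a permutation other than the identity moves at least two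
  indices, \<open>i\<close> and \<open>p i\<close>. The product rule differentiates only one factor,
  so an off-diagonal zero of the identity matrix survives in each summand. Only the identity
  permutation contributes, and it gives the trace.\<close>

lemma has_real_derivative_det_mat_1:
  fixes X :: "real^'n^'n"
  shows "((\<lambda>s. det (mat 1 + s *\<^sub>R X)) has_real_derivative trace X) (at 0)"
proof -
  define e :: "('n \<Rightarrow> 'n) \<Rightarrow> 'n \<Rightarrow> real" where "e p i = (if i = p i then 1 else 0)" for p i
  define D where "D p = (\<Sum>i\<in>UNIV. X $ i $ p i * (\<Prod>k\<in>UNIV - {i}. e p k))" for p
  have nz: "D p = 0" if p: "p permutes UNIV" "p \<noteq> id" for p
  proof -
    obtain i where i: "p i \<noteq> i" using p(2) by (auto simp: fun_eq_iff)
    then have pi: "p (p i) \<noteq> p i" using permutes_inj[OF p(1)] by (metis injD)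
    have "(\<Prod>k\<in>UNIV - {j}. e p k) = 0" for j
    proof (rule prod_zero)
      show "\<exists>k\<in>UNIV - {j}. e p k = 0"
        using i pi by (metis DiffI UNIV_I e_def singletonD)
    qed simp
    then show ?thesis by (simp only: D_def mult_zero_right sum.neutral_const)
  qed
  have "((\<lambda>s. \<Prod>i\<in>UNIV. (mat 1 + s *\<^sub>R X) $ i $ p i) has_real_derivative D p) (at 0)" for p
  proof -
    have f: "(\<lambda>s. (mat 1 + s *\<^sub>R X) $ i $ p i) = (\<lambda>s. e p i + s * X $ i $ p i)" for i
      by (simp add: mat_def e_def)
    have "((\<lambda>s. e p i + s * X $ i $ p i) has_real_derivative X $ i $ p i) (at 0)" for i
      by (auto intro!: derivative_eq_intros)
    then have "((\<lambda>s. \<Prod>i\<in>UNIV. e p i + s * X $ i $ p i) has_real_derivative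
        (\<Sum>i\<in>UNIV. X $ i $ p i * (\<Prod>k\<in>UNIV - {i}. e p k + 0 * X $ k $ p k))) (at 0)"
      by (intro has_field_derivative_prod)
    then show ?thesis by (simp add: D_def mat_def e_def)
  qed
  then have "((\<lambda>s. det (mat 1 + s *\<^sub>R X)) has_real_derivative
      (\<Sum>p | p permutes UNIV. of_int (sign p) * D p)) (at 0)"
    unfolding det_def by (intro DERIV_sum DERIV_cmult) auto
  also have "(\<Sum>p | p permutes (UNIV::'n set). of_int (sign p) * D p) = (\<Sum>p\<in>{id}. of_int (sign p) * D p)"
    by (rule sum.mono_neutral_right) (auto simp: finite_permutations nz permutes_id)
  also have "\<dots> = trace X" by (simp add: D_def e_def trace_def)
  finally show ?thesis .
qed

section \<open>Symmetric matrices and perturbation of positive definite ones\<close>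

lemma symmetric_matrix_inner:
  "symmetric_matrix A \<Longrightarrow> (A *v x) \<bullet> y = x \<bullet> (A *v y)"
  by (metis dot_lmul_matrix symmetric_matrix_def transpose_matrix_vector)

lemma symmetric_matrix_add:
  "symmetric_matrix A \<Longrightarrow> symmetric_matrix B \<Longrightarrow> symmetric_matrix (A + B)"
  by (simp add: symmetric_matrix_def transpose_def vec_eq_iff)

lemma symmetric_matrix_diff:
  "symmetric_matrix A \<Longrightarrow> symmetric_matrix B \<Longrightarrow> symmetric_matrix (A - B)"
  by (simp add: symmetric_matrix_def transpose_def vec_eq_iff)

lemma symmetric_matrix_uminus:
  "symmetric_matrix A \<Longrightarrow> symmetric_matrix (- A)"
  by (simp add: symmetric_matrix_def transpose_def vec_eq_iff)

lemma symmetric_matrix_scaleR: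
  "symmetric_matrix A \<Longrightarrow> symmetric_matrix (c *\<^sub>R A)"
  by (simp add: symmetric_matrix_def transpose_def vec_eq_iff)

lemma pos_def_scaleR:
  assumes "pos_def A" "0 < c"
  shows "pos_def (c *\<^sub>R A)"
  using assms by (simp add: pos_def_def symmetric_matrix_scaleR flip: scaleR_matrix_vector_assoc)

text \<open>By compactness the quadratic form of \<open>B\<close> has a positive minimum
  \<open>m\<close> on the unit sphere, while \<open>s *\<^sub>R C\<close> changes the form there by
  at most \<open>s * c\<close>. Homogeneity extends the bound to all nonzero vectors.\<close>

lemma eventually_pos_def_perturb:
  fixes B C :: "real^'n^'n"
  assumes B: "pos_def B" and C: "symmetric_matrix C"
  shows "\<forall>\<^sub>F s in at_right 0. pos_def (B + s *\<^sub>R C)"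
proof -
  have "compact (sphere (0::real^'n) 1)" by simp
  moreover have "sphere (0::real^'n) 1 \<noteq> {}" by simp
  moreover have "continuous_on (sphere 0 1) (\<lambda>x. x \<bullet> (B *v x))"
    by (intro continuous_intros matrix_vector_mult_linear_continuous_on)
  ultimately obtain x0 where x0: "x0 \<in> sphere 0 1"
      "\<And>x. x \<in> sphere 0 1 \<Longrightarrow> x0 \<bullet> (B *v x0) \<le> x \<bullet> (B *v x)"
    using continuous_attains_inf[of "sphere 0 1" "\<lambda>x. x \<bullet> (B *v x)"] by blast
  define m where "m = x0 \<bullet> (B *v x0)"
  have "x0 \<noteq> 0" using x0(1) by auto
  then have m: "0 < m" using B by (simp add: m_def pos_def_def)
  \<comment> \<open>The added 1 keeps \<open>c\<close> positive even for \<open>C = 0\<close>, so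
    that \<open>m / c\<close> is a genuine positive threshold.\<close>
  define c where "c = onorm (\<lambda>x. C *v x) + 1"
  have bl: "bounded_linear (\<lambda>x. C *v x)" by (rule matrix_vector_mul_bounded_linear)
  have c: "0 < c" "norm (C *v x) \<le> c * norm x" for x
    using onorm_pos_le[OF bl] onorm[OF bl, of x] by (auto simp: c_def distrib_right add_increasing2)
  have "pos_def (B + s *\<^sub>R C)" if s: "0 < s" "s < m / c" for s
    unfolding pos_def_def
  proof (intro conjI allI impI)
    show "symmetric_matrix (B + s *\<^sub>R C)"
      using B C by (simp add: symmetric_matrix_add symmetric_matrix_scaleR pos_def_def)
    fix x :: "real^'n" assume x: "x \<noteq> 0"
    define y where "y = x /\<^sub>R norm x"
    have y: "norm y = 1" "x = norm x *\<^sub>R y" using x by (auto simp: y_def)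
    have "\<bar>y \<bullet> (C *v y)\<bar> \<le> norm y * norm (C *v y)" by (rule Cauchy_Schwarz_ineq2)
    also have "\<dots> \<le> c" using c(2)[of y] y by simp
    finally have "s * \<bar>y \<bullet> (C *v y)\<bar> \<le> s * c" using s by simp
    also have "\<dots> < m" using s c by (simp add: field_simps)
    finally have "s * \<bar>y \<bullet> (C *v y)\<bar> < m" .
    moreover have "m \<le> y \<bullet> (B *v y)" using x0(2)[of y] y by (simp add: m_def)
    moreover have "- (s * (y \<bullet> (C *v y))) \<le> s * \<bar>y \<bullet> (C *v y)\<bar>"
      using s by (metis abs_ge_minus_self abs_mult abs_of_pos)
    ultimately have "0 < y \<bullet> ((B + s *\<^sub>R C) *v y)"
      by (simp add: matrix_vector_mult_add_rdistrib inner_add_right flip: scaleR_matrix_vector_assoc)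
    moreover have "x \<bullet> ((B + s *\<^sub>R C) *v x) = (norm x)\<^sup>2 * (y \<bullet> ((B + s *\<^sub>R C) *v y))"
      by (subst (1 2) y(2)) (simp add: matrix_vector_mult_scaleR power2_eq_square)
    ultimately show "0 < x \<bullet> ((B + s *\<^sub>R C) *v x)" using x by simp
  qed
  then show ?thesis
    using m c(1) by (auto simp: eventually_at_right_field intro!: exI[of _ "m / c"])
qed

section \<open>Rank-one matrices, the trace pairing and the Lyapunov equation\<close>

definition outer :: "real^'n \<Rightarrow> real^'m \<Rightarrow> real^'m^'n" where
  "outer u v = (\<chi> i. u $ i *\<^sub>R v)"

lemma inner_outer: "H \<bullet> outer u v = u \<bullet> (H *v v)"
  by (simp add: outer_def inner_vec_def matrix_vector_mult_def sum_distrib_left mult_ac)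

lemma outer_mult_vector: "outer u v *v x = (v \<bullet> x) *\<^sub>R u"
  by (simp add: outer_def inner_vec_def matrix_vector_mult_def vec_eq_iff sum_distrib_left mult_ac)

lemma sum_matrix_vector_mult: "sum M I *v x = (\<Sum>i\<in>I. M i *v x)"
  for M :: "'i \<Rightarrow> real^'n^'m"
  by (induction I rule: infinite_finite_induct) (simp_all add: matrix_vector_mult_add_rdistrib)

text \<open>This links the entrywise inner product, in which hyperplanes are separated, with the
  trace, in which the derivative of the determinant is expressed.\<close>

lemma trace_inner:
  assumes "symmetric_matrix C"
  shows "trace (R ** C) = C \<bullet> R"
  using assms
  by (simp add: trace_def inner_vec_def matrix_matrix_mult_def symmetric_matrix_def transpose_def vec_eq_iff mult.commute)

text \<open>The normal of a separating hyperplane in matrix space need not be symmetric. Its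
  symmetric part acts identically on symmetric matrices and is an admissible direction for
  \<open>B\<close>.\<close>

lemma inner_symmetric_part:
  assumes "symmetric_matrix X"
  shows "((1/2) *\<^sub>R (H + transpose H)) \<bullet> X = H \<bullet> X"
proof -
  have "transpose H \<bullet> X = H \<bullet> transpose X"
    unfolding inner_vec_def transpose_def by (simp) (rule sum.swap)
  then show ?thesis using assms by (simp add: symmetric_matrix_def inner_add_left)
qed

text \<open>Multiplying the equation by \<open>X\<close> and taking traces gives
  \<open>2 * trace (X ** (B ** X)) = 0\<close>. This trace is the sum of the quadratic form of
  \<open>B\<close> over the columns of \<open>X\<close>, so positive definiteness makes every column
  vanish.\<close>

lemma lyapunov_unique:
  fixes B X :: "real^'n^'n"
  assumes B: "pos_def B" and X: "symmetric_matrix X" and eq: "B ** X + X ** B = 0"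
  shows "X = 0"
proof -
  have 1: "y \<bullet> (B *v (X *v x)) + (X *v y) \<bullet> (B *v x) = 0" for x y
  proof -
    have "y \<bullet> ((B ** X + X ** B) *v x) = 0" by (simp add: eq)
    then show ?thesis
      by (simp add: matrix_vector_mult_add_rdistrib inner_add_right symmetric_matrix_inner[OF X]
          flip: matrix_vector_mul_assoc)
  qed
  have tr: "(\<Sum>i\<in>UNIV. axis i 1 \<bullet> (M *v axis i 1)) = trace M" for M :: "real^'n^'n"
    by (simp add: trace_def inner_axis' matrix_vector_mult_basis column_def)
  have a: "(\<Sum>i\<in>UNIV. (X *v axis i 1) \<bullet> (B *v (X *v axis i 1))) = trace (X ** (B ** X))"
    by (simp add: symmetric_matrix_inner[OF X] matrix_vector_mul_assoc flip: tr)
  have b: "(\<Sum>i\<in>UNIV. (X *v (X *v axis i 1)) \<bullet> (B *v axis i 1)) = trace (X ** (X ** B))"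
    unfolding symmetric_matrix_inner[OF X] by (simp add: matrix_vector_mul_assoc matrix_mul_assoc flip: tr)
  have "trace (X ** (B ** X)) + trace (X ** (X ** B)) = 0"
    unfolding a[symmetric] b[symmetric] sum.distrib[symmetric] by (simp add: 1)
  moreover have "trace (X ** (X ** B)) = trace (X ** (B ** X))"
    by (metis matrix_mul_assoc trace_mul_sym)
  ultimately have s: "(\<Sum>i\<in>UNIV. (X *v axis i 1) \<bullet> (B *v (X *v axis i 1))) = 0"
    using a by simp
  have nonneg: "0 \<le> x \<bullet> (B *v x)" for x
    using B by (cases "x = 0") (auto simp: pos_def_def intro: less_imp_le)
  have "X *v axis i 1 = 0" for i
  proof -
    have "(X *v axis i 1) \<bullet> (B *v (X *v axis i 1)) = 0"
      using s by (simp add: sum_nonneg_eq_0_iff nonneg)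
    then show ?thesis using B by (auto simp: pos_def_def)
  qed
  then have "column i X = 0" for i by (simp add: matrix_vector_mult_basis)
  then show ?thesis by (simp add: column_def vec_eq_iff)
qed

section \<open>Optimality conditions for the inscribed ellipsoid\<close>

text \<open>A ball inside the polytope is feasible with a finite objective value, whereas
  \<open>log_det\<close> is \<open>- \<infinity>\<close> at every matrix that is not positive
  definite.\<close>

lemma mvie_optimal_pos_def:
  fixes S :: "real^'k^'j" and t :: "real^'j"
  assumes int: "interior {x. S *v x \<le> t} \<noteq> {}" and opt: "mvie_optimal S t B d"
  shows "pos_def B"
proof -
  obtain x r where r: "0 < r" and sub: "cball x r \<subseteq> {x. S *v x \<le> t}"
    using int by (auto simp: mem_interior_cball)
  have pd: "pos_def (r *\<^sub>R mat 1 :: real^'k^'k)"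
    using r by (intro pos_def_scaleR) (auto simp: pos_def_def symmetric_matrix_def)
  have "mvie_feasible S t (r *\<^sub>R mat 1) x"
    unfolding mvie_feasible_def
  proof (intro conjI allI)
    show "symmetric_matrix (r *\<^sub>R mat 1 :: real^'k^'k)" using pd by (simp add: pos_def_def)
    fix j
    define s where "s = row j S"
    \<comment> \<open>The point of the ball that is extreme in direction \<open>s\<close>. For
      \<open>s = 0\<close> the quotient is 0 and \<open>y\<close> is the center.\<close>
    define y where "y = x + (r / norm s) *\<^sub>R s"
    have "y \<in> cball x r" using r by (cases "s = 0") (auto simp: y_def dist_norm)
    then have "(S *v y) $ j \<le> t $ j" using sub by (auto simp: less_eq_vec_def)
    also have "(S *v y) $ j = s \<bullet> y"
      by (simp add: s_def matrix_vector_mult_def inner_vec_def row_def)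
    also have "\<dots> = r * norm s + s \<bullet> x"
      by (cases "s = 0") (auto simp: y_def inner_add_right dot_square_norm power2_eq_square)
    finally show "norm ((r *\<^sub>R mat 1) *v row j S) + row j S \<bullet> x \<le> t $ j"
      using r by (simp add: s_def flip: scaleR_matrix_vector_assoc)
  qed
  then have "log_det (r *\<^sub>R mat 1 :: real^'k^'k) \<le> log_det B"
    using opt unfolding mvie_optimal_def by blast
  then show ?thesis using pd by (auto simp: log_det_def split: if_splits)
qed

text \<open>If \<open>C \<bullet> R\<close> were positive, a small step along \<open>(C, e)\<close>
  would increase the determinant, whose logarithmic derivative at \<open>B\<close> is
  \<open>trace (R ** C)\<close>. Active constraints decrease to first order by \<open>dec\<close>,
  inactive ones persist by continuity, and positive definiteness is an open condition. The step
  would thus contradict optimality.\<close>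

lemma mvie_no_improving_direction:
  fixes S :: "real^'k^'j" and B C R :: "real^'k^'k"
  assumes opt: "mvie_optimal S t B d" and B: "pos_def B" and R: "B ** R = mat 1"
    and C: "symmetric_matrix C"
    and dec: "\<And>j. B *v row j S \<noteq> 0 \<Longrightarrow> norm (B *v row j S) + row j S \<bullet> d = t $ j \<Longrightarrow>
      (B *v row j S) \<bullet> (C *v row j S) / norm (B *v row j S) + row j S \<bullet> e < 0"
  shows "C \<bullet> R \<le> 0"
proof (rule ccontr)
  assume "\<not> C \<bullet> R \<le> 0"
  then have tr: "0 < trace (R ** C)" using trace_inner[OF C, of R] by simp
  have feas: "norm (B *v row j S) + row j S \<bullet> d \<le> t $ j" for j
    using opt by (simp add: mvie_optimal_def mvie_feasible_def)
  have ev_det: "\<forall>\<^sub>F s in at_right 0. det B < det (B + s *\<^sub>R C)"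
  proof -
    obtain \<delta> where \<delta>: "\<delta> > 0" "\<And>s. 0 < s \<Longrightarrow> s < \<delta> \<Longrightarrow> 1 < det (mat 1 + s *\<^sub>R (R ** C))"
      using has_real_derivative_pos_inc_right[OF has_real_derivative_det_mat_1[of "R ** C"] tr] by auto
    have "det B < det (B + s *\<^sub>R C)" if "0 < s" "s < \<delta>" for s
    proof -
      \<comment> \<open>Factoring out \<open>B\<close> reduces the growth of the determinant to its
        derivative at the identity.\<close>
      have "B + s *\<^sub>R C = B ** (mat 1 + s *\<^sub>R (R ** C))"
        by (simp add: matrix_add_ldistrib matrix_scalar_ac matrix_mul_assoc R flip: scalar_matrix_assoc)
      then show ?thesis using \<delta>(2)[OF that] pos_def_det_pos[OF B] by (simp add: det_mul)
    qed
    then show ?thesis using \<delta>(1) by (auto simp: eventually_at_right_field)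
  qed
  have ev_con: "\<forall>\<^sub>F s in at_right 0.
      norm ((B + s *\<^sub>R C) *v row j S) + row j S \<bullet> (d + s *\<^sub>R e) \<le> t $ j" for j
  proof -
    define u where "u = row j S"
    define f where "f s = norm (B *v u + s *\<^sub>R (C *v u)) + u \<bullet> (d + s *\<^sub>R e)" for s
    have f: "norm ((B + s *\<^sub>R C) *v u) + u \<bullet> (d + s *\<^sub>R e) = f s" for s
      by (simp add: f_def matrix_vector_mult_add_rdistrib flip: scaleR_matrix_vector_assoc)
    have f0: "f 0 = norm (B *v u) + u \<bullet> d" by (simp add: f_def)
    \<comment> \<open>The norm is not differentiable at 0, so \<open>B *v u = 0\<close> is split
      off. There \<open>u = 0\<close>, and the constraint does not depend on
      \<open>s\<close>.\<close>
    consider "B *v u = 0" | "norm (B *v u) + u \<bullet> d < t $ j"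
      | "B *v u \<noteq> 0" "norm (B *v u) + u \<bullet> d = t $ j"
      using feas[of j] by (force simp: u_def)
    then have "\<forall>\<^sub>F s in at_right 0. f s \<le> t $ j"
    proof cases
      case 1
      then have "u = 0" using B by (force simp: pos_def_def)
      then show ?thesis using feas[of j] by (simp add: f_def flip: u_def)
    next
      case 2
      have "(f \<longlongrightarrow> f 0) (at_right 0)"
        unfolding f_def by (intro tendsto_eq_intros) auto
      then have "\<forall>\<^sub>F s in at_right 0. f s < t $ j"
        using 2 f0 by (intro order_tendstoD) auto
      then show ?thesis by (rule eventually_mono) simp
    next
      case 3
      \<comment> \<open>The derivative at \<open>s = 0\<close> of the left-hand side of the
        constraint.\<close>
      define l where "l = (B *v u) \<bullet> (C *v u) / norm (B *v u) + u \<bullet> e"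
      have l: "l < 0" using dec[of j] 3 by (simp add: l_def u_def)
      have nd: "(norm has_derivative (\<lambda>h. h \<bullet> sgn (B *v u))) (at (B *v u + 0 *\<^sub>R (C *v u)))"
        using has_derivative_norm[of "B *v u"] 3 by simp
      have "((\<lambda>s. B *v u + s *\<^sub>R (C *v u)) has_derivative (\<lambda>s. s *\<^sub>R (C *v u))) (at 0)"
        by (auto intro!: derivative_eq_intros)
      from has_derivative_compose[OF this nd]
      have "((\<lambda>s. norm (B *v u + s *\<^sub>R (C *v u))) has_real_derivative (C *v u) \<bullet> sgn (B *v u)) (at 0)"
        by (simp add: has_field_derivative_def mult.commute[of _ "(C *v u) \<bullet> _"])
      then have "(f has_real_derivative l) (at 0)"
        unfolding f_def l_def
        by (auto intro!: derivative_eq_intros simp: sgn_div_norm inner_commute inner_add_right divide_inverse)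
      from has_real_derivative_neg_dec_right[OF this l] obtain \<delta> where
        "\<delta> > 0" "\<And>s. 0 < s \<Longrightarrow> s < \<delta> \<Longrightarrow> f s < f 0" by auto
      then show ?thesis using 3 f0 by (auto simp: eventually_at_right_field less_imp_le intro!: exI[of _ \<delta>])
    qed
    then show ?thesis by (simp add: f flip: u_def)
  qed
  have "\<forall>\<^sub>F s in at_right 0. pos_def (B + s *\<^sub>R C) \<and> det B < det (B + s *\<^sub>R C) \<and>
      (\<forall>j. norm ((B + s *\<^sub>R C) *v row j S) + row j S \<bullet> (d + s *\<^sub>R e) \<le> t $ j)"
    using eventually_pos_def_perturb[OF B C] ev_det ev_con
    by (auto intro!: eventually_conj eventually_all_finite)
  then obtain s where s: "pos_def (B + s *\<^sub>R C)" "det B < det (B + s *\<^sub>R C)"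
      "mvie_feasible S t (B + s *\<^sub>R C) (d + s *\<^sub>R e)"
    by (auto simp: mvie_feasible_def pos_def_def dest!: eventually_happens)
  then have "log_det (B + s *\<^sub>R C) \<le> log_det B" using opt unfolding mvie_optimal_def by blast
  then show False
    using s B pos_def_det_pos[OF B] pos_def_det_pos[OF s(1)] by (simp add: log_det_def)
qed

text \<open>The point \<open>((1 / K) *\<^sub>R R, 0)\<close> must lie in the convex hull of the
  normalized gradients of the active constraints, for otherwise a separating hyperplane supplies an
  improving direction. The convex weights are the \<open>\<theta> j\<close>. The vector component
  gives the first identity, and the matrix component gives a Lyapunov equation for the
  second.\<close>

lemma john_decomposition:
  fixes S :: "real^'k^'j" and B R :: "real^'k^'k"
  assumes opt: "mvie_optimal S t B d" and B: "pos_def B" and R: "B ** R = mat 1" "R ** B = mat 1"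
    and symR: "symmetric_matrix R"
  obtains \<theta> :: "'j \<Rightarrow> real" where
    "\<And>j. 0 \<le> \<theta> j" "sum \<theta> UNIV = 1"
    "\<And>j. \<theta> j \<noteq> 0 \<Longrightarrow> B *v row j S \<noteq> 0 \<and> norm (B *v row j S) + row j S \<bullet> d = t $ j"
    "(\<Sum>j\<in>UNIV. (\<theta> j / norm (B *v row j S)) *\<^sub>R row j S) = 0"
    "(\<Sum>j\<in>UNIV. (\<theta> j / (norm (B *v row j S))\<^sup>2) *\<^sub>R outer (row j S) (row j S)) =
      (1 / real CARD('k)) *\<^sub>R (R ** R)"
proof -
  define s where "s j = row j S" for j
  define n where "n j = norm (B *v s j)" for j
  define I where "I = {j. B *v s j \<noteq> 0 \<and> n j + s j \<bullet> d = t $ j}"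
  \<comment> \<open>Up to the factor \<open>1 / n j\<close>, \<open>P j\<close> and
    \<open>q j\<close> are the gradients of the constraint function with respect to symmetric
    \<open>B\<close> and to \<open>d\<close>. The factor makes
    \<open>B \<bullet> P j = 1\<close>.\<close>
  define P where "P j = (1 / (2 * (n j)\<^sup>2)) *\<^sub>R (outer (B *v s j) (s j) + outer (s j) (B *v s j))" for j
  define q where "q j = (1 / n j) *\<^sub>R s j" for j
  define K where "K = real CARD('k)"
  have K: "0 < K" by (simp add: K_def)
  have symB: "symmetric_matrix B" using B by (simp add: pos_def_def)
  have symP: "symmetric_matrix (P j)" for j
    by (simp add: P_def symmetric_matrix_def transpose_def outer_def vec_eq_iff)
  have CP: "C \<bullet> P j = (B *v s j) \<bullet> (C *v s j) / (n j)\<^sup>2" if "symmetric_matrix C" for C j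
    using symmetric_matrix_inner[OF that, of "s j" "B *v s j"]
    by (simp add: P_def inner_add_right inner_outer inner_commute)
  have "((1 / K) *\<^sub>R R, 0) \<in> convex hull ((\<lambda>j. (P j, q j)) ` I)"
  proof (rule ccontr)
    assume "\<not> ?thesis"
    then obtain a \<beta> where a: "a \<bullet> ((1 / K) *\<^sub>R R, 0) < \<beta>"
        "\<forall>x\<in>convex hull ((\<lambda>j. (P j, q j)) ` I). a \<bullet> x > \<beta>"
      using separating_hyperplane_closed_point[of "convex hull ((\<lambda>j. (P j, q j)) ` I)" "((1 / K) *\<^sub>R R, 0)"]
      by (auto simp: compact_imp_closed finite_imp_compact_convex_hull)
    obtain H w where Hw: "a = (H, w)" by (cases a)
    define H' where "H' = (1/2) *\<^sub>R (H + transpose H)"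
    \<comment> \<open>Since \<open>B \<bullet> P j = 1\<close> and \<open>B \<bullet> R = K\<close>,
      the multiple of \<open>B\<close> absorbs the offset \<open>\<beta>\<close> of the hyperplane.
      Together with \<open>- w\<close> as the shift of \<open>d\<close>, separation makes all active
      constraints decrease while \<open>C \<bullet> R > 0\<close>.\<close>
    define C where "C = \<beta> *\<^sub>R B - H'"
    have symC: "symmetric_matrix C"
      using symB by (auto simp: C_def H'_def symmetric_matrix_def transpose_def vec_eq_iff)
    have "C \<bullet> R \<le> 0"
    proof (rule mvie_no_improving_direction[OF opt B R(1) symC, where e = "- w"])
      fix j assume "B *v row j S \<noteq> 0" "norm (B *v row j S) + row j S \<bullet> d = t $ j"
      then have j: "j \<in> I" and nz: "B *v s j \<noteq> 0" by (auto simp: I_def n_def s_def)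
      then have n: "0 < n j" by (simp add: n_def)
      have "B \<bullet> P j = 1" using n by (simp add: CP[OF symB] dot_square_norm flip: n_def)
      moreover have "\<beta> < H \<bullet> P j + w \<bullet> q j"
        using a(2) j hull_inc[of "(P j, q j)" "(\<lambda>j. (P j, q j)) ` I" convex] by (auto simp: Hw)
      moreover have "H' \<bullet> P j = H \<bullet> P j" unfolding H'_def by (rule inner_symmetric_part[OF symP])
      ultimately have "C \<bullet> P j - w \<bullet> q j < 0" by (simp add: C_def inner_diff_left)
      \<comment> \<open>Multiplying by \<open>n j\<close> undoes the normalization and recovers the
        directional derivative.\<close>
      then have "n j * (C \<bullet> P j - w \<bullet> q j) < 0" using n by (simp add: mult_pos_neg)
      also have "n j * (C \<bullet> P j - w \<bullet> q j) = (B *v s j) \<bullet> (C *v s j) / n j - s j \<bullet> w"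
        using n by (simp add: CP[OF symC] q_def right_diff_distrib inner_commute power2_eq_square)
      finally show "(B *v row j S) \<bullet> (C *v row j S) / norm (B *v row j S) + row j S \<bullet> - w < 0"
        by (simp add: n_def s_def)
    qed
    moreover have "B \<bullet> R = K"
      using trace_inner[OF symB, of R] by (simp add: R K_def trace_I)
    moreover have "H' \<bullet> R = H \<bullet> R" unfolding H'_def by (rule inner_symmetric_part[OF symR])
    moreover have "H \<bullet> R < \<beta> * K" using a(1) K by (simp add: Hw field_simps)
    ultimately show False by (simp add: C_def inner_diff_left)
  qed
  then obtain \<theta> where \<theta>: "\<And>i. 0 \<le> \<theta> i" "\<And>i. i \<notin> I \<Longrightarrow> \<theta> i = 0" "sum \<theta> I = 1"
      "(\<Sum>i\<in>I. \<theta> i *\<^sub>R (P i, q i)) = ((1 / K) *\<^sub>R R, 0)"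
    by (rule convex_hull_image_weights[rotated]) auto
  have ext: "sum f I = sum f UNIV" if "\<And>i. i \<notin> I \<Longrightarrow> f i = 0" for f :: "'j \<Rightarrow> 'a::comm_monoid_add"
    using that by (intro sum.mono_neutral_left) auto
  have sP: "(\<Sum>i\<in>UNIV. \<theta> i *\<^sub>R P i) = (1 / K) *\<^sub>R R" and sq: "(\<Sum>i\<in>UNIV. \<theta> i *\<^sub>R q i) = 0"
    using arg_cong[OF \<theta>(4), of fst] arg_cong[OF \<theta>(4), of snd]
    by (simp_all add: fst_sum snd_sum ext \<theta>(2))
  define M where "M = (\<Sum>j\<in>UNIV. (\<theta> j / (n j)\<^sup>2) *\<^sub>R outer (s j) (s j))"
  have Mv: "M *v x = (\<Sum>j\<in>UNIV. (\<theta> j / (n j)\<^sup>2 * (s j \<bullet> x)) *\<^sub>R s j)" for x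
    unfolding M_def by (simp add: sum_matrix_vector_mult outer_mult_vector flip: scaleR_matrix_vector_assoc)
  have symM: "symmetric_matrix M"
    by (simp add: M_def symmetric_matrix_def transpose_def outer_def vec_eq_iff mult_ac)
  have RR: "symmetric_matrix (R ** R)"
    using symR by (simp add: symmetric_matrix_def matrix_transpose_mul)
  define X where "X = M - (1 / K) *\<^sub>R (R ** R)"
  \<comment> \<open>Only symmetric perturbations of \<open>B\<close> are admissible, so optimality determines just the
    symmetric part of \<open>B ** M\<close>; Lyapunov uniqueness then recovers \<open>M\<close>.\<close>
  have lyap: "B ** M + M ** B = (2 / K) *\<^sub>R R"
    unfolding matrix_eq
  proof
    fix x
    have "(B ** M + M ** B) *v x = B *v (M *v x) + M *v (B *v x)"
      by (simp add: matrix_vector_mult_add_rdistrib matrix_vector_mul_assoc)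
    also have "\<dots> = (\<Sum>j\<in>UNIV. (\<theta> j / (n j)\<^sup>2) *\<^sub>R ((s j \<bullet> x) *\<^sub>R (B *v s j) + ((B *v s j) \<bullet> x) *\<^sub>R s j))"
      by (simp add: Mv linear_sum[OF matrix_vector_mul_linear] matrix_vector_mult_scaleR
          symmetric_matrix_inner[OF symB] scaleR_add_right sum.distrib)
    also have "\<dots> = 2 *\<^sub>R ((\<Sum>j\<in>UNIV. \<theta> j *\<^sub>R P j) *v x)"
      by (simp add: sum_matrix_vector_mult P_def outer_mult_vector matrix_vector_mult_add_rdistrib
          scaleR_sum_right flip: scaleR_matrix_vector_assoc)
    also have "\<dots> = ((2 / K) *\<^sub>R R) *v x"
      by (simp add: sP flip: scaleR_matrix_vector_assoc)
    finally show "(B ** M + M ** B) *v x = ((2 / K) *\<^sub>R R) *v x" .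
  qed
  have "X = 0"
  proof (rule lyapunov_unique[OF B])
    show "symmetric_matrix X"
      using symM RR by (simp add: X_def symmetric_matrix_diff symmetric_matrix_scaleR)
    have "(B ** X + X ** B) *v x = 0" for x
    proof -
      have RB: "R *v (B *v x) = x" and BR: "B *v (R *v y) = y" for y
        by (simp_all add: matrix_vector_mul_assoc R)
      have "(B ** X + X ** B) *v x = (B ** M + M ** B) *v x
          - (1 / K) *\<^sub>R (B *v (R *v (R *v x))) - (1 / K) *\<^sub>R (R *v (R *v (B *v x)))"
        by (simp add: X_def matrix_vector_mult_add_rdistrib matrix_vector_mult_diff_rdistrib
            matrix_vector_mult_diff_distrib matrix_vector_mult_scaleR
            flip: matrix_vector_mul_assoc scaleR_matrix_vector_assoc)
      also have "\<dots> = (2 / K) *\<^sub>R (R *v x) - (1 / K) *\<^sub>R (R *v x) - (1 / K) *\<^sub>R (R *v x)"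
        by (simp only: lyap RB BR scaleR_matrix_vector_assoc)
      also have "\<dots> = 0" by (simp flip: scaleR_diff_left)
      finally show ?thesis .
    qed
    then show "B ** X + X ** B = 0" by (simp add: matrix_eq)
  qed
  then have M: "M = (1 / K) *\<^sub>R (R ** R)" by (simp add: X_def)
  show thesis
  proof (rule that[of \<theta>])
    show "sum \<theta> UNIV = 1" using \<theta>(2,3) by (simp add: ext)
    show "B *v row j S \<noteq> 0 \<and> norm (B *v row j S) + row j S \<bullet> d = t $ j" if "\<theta> j \<noteq> 0" for j
      using \<theta>(2)[of j] that by (auto simp: I_def n_def s_def)
    show "(\<Sum>j\<in>UNIV. (\<theta> j / norm (B *v row j S)) *\<^sub>R row j S) = 0"
      using sq by (simp add: q_def n_def s_def)
    show "(\<Sum>j\<in>UNIV. (\<theta> j / (norm (B *v row j S))\<^sup>2) *\<^sub>R outer (row j S) (row j S)) =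
        (1 / real CARD('k)) *\<^sub>R (R ** R)"
      using M by (simp add: M_def K_def n_def s_def)
  qed (rule \<theta>(1))
qed

section \<open>Block and Gram matrices\<close>

lemma transpose_hcat: "transpose (hcat A B) = vcat (transpose A) (transpose B)"
  by (auto simp: hcat_def vcat_def transpose_def vec_eq_iff split: sum.split)

lemma vcat_mult_hcat: "vcat A B ** hcat C D = vcat (hcat (A ** C) (A ** D)) (hcat (B ** C) (B ** D))"
  by (auto simp: hcat_def vcat_def matrix_matrix_mult_def vec_eq_iff split: sum.split)

lemma vcat_mult: "vcat A B ** C = vcat (A ** C) (B ** C)"
  by (auto simp: vcat_def matrix_matrix_mult_def vec_eq_iff split: sum.split)

lemma mult_hcat: "A ** hcat C D = hcat (A ** C) (A ** D)"
  by (auto simp: hcat_def matrix_matrix_mult_def vec_eq_iff split: sum.split)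

lemma hcat_mult_vector: "hcat A B *v y = A *v (\<chi> i. y $ Inl i) + B *v (\<chi> i. y $ Inr i)"
  for A :: "real^'a^'m" and B :: "real^'b^'m"
proof -
  have "(\<Sum>k\<in>UNIV. f k) = (\<Sum>i\<in>UNIV. f (Inl i)) + (\<Sum>i\<in>UNIV. f (Inr i))"
    for f :: "'a + 'b \<Rightarrow> real"
    by (subst UNIV_Plus_UNIV[symmetric], subst sum.Plus) auto
  then show ?thesis by (simp add: vec_eq_iff matrix_vector_mult_def hcat_def)
qed

lemma columnvector_mult_vector: "(columnvector v :: real^1^'n) *v y = (y $ 1) *\<^sub>R v"
  by (simp add: vec_eq_iff matrix_vector_mult_def columnvector_def mult.commute)

lemma rowvector_mult: "(rowvector v :: real^'n^1) ** M = rowvector (v v* M)"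
  by (simp add: vec_eq_iff matrix_matrix_mult_def rowvector_def vector_matrix_mult_def mult.commute)

lemma rowvector_mult_columnvector: "(rowvector v :: real^'n^1) ** (columnvector w :: real^1^'n) = mat (v \<bullet> w)"
  by (simp add: vec_eq_iff matrix_matrix_mult_def rowvector_def columnvector_def inner_vec_def mat_def)

lemma inner_gram: "y \<bullet> ((transpose G ** N ** G) *v y) = (G *v y) \<bullet> (N *v (G *v y))"
  for G :: "real^'n^'m"
  by (metis dot_lmul_matrix inner_commute matrix_vector_mul_assoc transpose_matrix_vector)

lemma inner_gram': "y \<bullet> ((transpose G ** G) *v y) = (norm (G *v y))\<^sup>2"
  for G :: "real^'n^'m"
  using inner_gram[of y G "mat 1"] by (simp add: dot_square_norm)

lemma symmetric_gram: "symmetric_matrix N \<Longrightarrow> symmetric_matrix (transpose G ** N ** G)"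
  for G :: "real^'n^'m"
  by (simp add: symmetric_matrix_def matrix_transpose_mul matrix_mul_assoc)

lemma symmetric_gram': "symmetric_matrix (transpose G ** G)"
  for G :: "real^'n^'m"
  by (simp add: symmetric_matrix_def matrix_transpose_mul)

section \<open>Feasibility in the semidefinite program\<close>

text \<open>With this choice of \<open>F\<close>, \<open>g\<close>, \<open>h\<close>, the second
  block matrix is the Gram matrix of \<open>[A b 1]\<close> and hence positive semidefinite. The
  first matrix inequality, tested on the vector with blocks \<open>x\<close> and \<open>z\<close>,
  is \<open>quad\<close>. Symmetry of \<open>N\<close> supplies the symmetry contained in the
  Loewner order.\<close>

lemma sdp_feasible_gram:
  fixes S :: "real^'k^'j"
  assumes A: "symmetric_matrix A" and N: "symmetric_matrix N" "\<And>i j. 0 \<le> N $ i $ j"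
    and quad: "\<And>x z. (z *\<^sub>R t - S *v x) \<bullet> (N *v (z *\<^sub>R t - S *v x)) + (norm (A *v x + z *\<^sub>R b))\<^sup>2 \<le> z\<^sup>2"
  shows "sdp_feasible S t A b N (A ** A) (A *v b) (b \<bullet> b)"
  unfolding sdp_feasible_def
proof (intro conjI)
  have tA: "transpose A = A" using A by (simp add: symmetric_matrix_def)
  have bA: "(rowvector b :: real^'k^1) ** A = rowvector (A *v b)"
    by (metis rowvector_mult tA transpose_matrix_vector)
  show "symmetric_matrix (A ** A)" by (simp add: symmetric_matrix_def matrix_transpose_mul tA)
  define G where "G = hcat A (columnvector b :: real^1^'k)"
  define W where "W = hcat (- S) (columnvector t :: real^1^'j)"
  \<comment> \<open>The Gram matrix of this row has its only nonzero entry, 1, in the corner, and so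
    accounts for the \<open>- 1\<close> in \<open>h - 1\<close>.\<close>
  define e where "e = hcat (0 :: real^'k^1) (mat 1 :: real^1^1)"
  have tW: "transpose W = vcat (- transpose S) (rowvector t :: real^'j^1)"
  proof -
    have "transpose (- S) = - transpose S" by (simp add: transpose_def vec_eq_iff)
    then show ?thesis by (simp add: W_def transpose_hcat transpose_columnvector)
  qed
  have GG: "transpose G ** G = vcat (hcat (A ** A) (columnvector (A *v b) :: real^1^'k))
      (hcat (rowvector (A *v b) :: real^'k^1) (mat (b \<bullet> b) :: real^1^1))"
    by (simp add: G_def transpose_hcat transpose_columnvector vcat_mult_hcat tA bA
        rowvector_mult_columnvector dot_rowvector_columnvector)
  have block: "vcat (hcat (A ** A) (columnvector (A *v b) :: real^1^'k))
      (hcat (rowvector (A *v b) :: real^'k^1) (mat (b \<bullet> b - 1) :: real^1^1))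
      = transpose G ** G - transpose e ** e"
    unfolding GG e_def transpose_hcat vcat_mult_hcat
    by (auto simp: vec_eq_iff vcat_def hcat_def mat_def transpose_def matrix_matrix_mult_def split: sum.split)
  show "vcat (hcat (A ** A) (columnvector (A *v b) :: real^1^'k))
      (hcat (rowvector (A *v b) :: real^'k^1) (mat (b \<bullet> b - 1) :: real^1^1))
      \<preceq> - (vcat (- transpose S) (rowvector t :: real^'j^1) ** N ** hcat (- S) (columnvector t :: real^1^'j))"
    unfolding loewner_le_def block tW[symmetric] W_def[symmetric] psd_def
  proof (intro conjI allI)
    show "symmetric_matrix (- (transpose W ** N ** W) - (transpose G ** G - transpose e ** e))"
      by (intro symmetric_matrix_diff symmetric_matrix_uminus symmetric_gram symmetric_gram' N)
    fix y :: "real^('k + 1)"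
    define x where "x = (\<chi> i. y $ Inl i)"
    define z where "z = y $ Inr 1"
    have Wy: "W *v y = z *\<^sub>R t - S *v x"
    proof -
      have "- S *v x = - (S *v x)" by (simp add: vec_eq_iff matrix_vector_mult_def sum_negf)
      then show ?thesis by (simp add: W_def hcat_mult_vector columnvector_mult_vector x_def z_def)
    qed
    have Gy: "G *v y = A *v x + z *\<^sub>R b"
      by (simp add: G_def hcat_mult_vector columnvector_mult_vector x_def z_def)
    have ey: "(norm (e *v y))\<^sup>2 = z\<^sup>2"
      by (simp add: e_def hcat_mult_vector z_def norm_real)
    have "y \<bullet> ((- (transpose W ** N ** W) - (transpose G ** G - transpose e ** e)) *v y)
      = - (y \<bullet> ((transpose W ** N ** W) *v y)) - y \<bullet> ((transpose G ** G) *v y) + y \<bullet> ((transpose e ** e) *v y)"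
    proof -
      have "- (transpose W ** N ** W) *v y = - ((transpose W ** N ** W) *v y)"
        by (simp add: vec_eq_iff matrix_vector_mult_def sum_negf)
      then show ?thesis by (simp add: matrix_vector_mult_diff_rdistrib inner_diff_right)
    qed
    then show "0 \<le> y \<bullet> ((- (transpose W ** N ** W) - (transpose G ** G - transpose e ** e)) *v y)"
      using quad[of z x] by (simp add: inner_gram inner_gram' Wy Gy ey del: transpose_matrix_vector)
  qed
  define G3 where "G3 = hcat A (hcat (columnvector b :: real^1^'k) (mat 1 :: real^'k^'k))"
  have "vcat (hcat (A ** A) (hcat (columnvector (A *v b) :: real^1^'k) A))
      (vcat (hcat (rowvector (A *v b) :: real^'k^1) (hcat (mat (b \<bullet> b) :: real^1^1) (rowvector b :: real^'k^1)))
      (hcat A (hcat (columnvector b :: real^1^'k) (mat 1)))) = transpose G3 ** G3"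
    unfolding G3_def transpose_hcat vcat_mult
    by (simp add: transpose_columnvector mult_hcat tA bA
        rowvector_mult_columnvector dot_rowvector_columnvector)
  then show "0 \<preceq> vcat (hcat (A ** A) (hcat (columnvector (A *v b) :: real^1^'k) A))
      (vcat (hcat (rowvector (A *v b) :: real^'k^1) (hcat (mat (b \<bullet> b) :: real^1^1) (rowvector b :: real^'k^1)))
      (hcat A (hcat (columnvector b :: real^1^'k) (mat 1))))"
    by (simp add: loewner_le_def psd_def symmetric_gram' inner_gram' del: transpose_matrix_vector)
qed (use A N in auto)

text \<open>The quadratic form of \<open>N\<close> is the difference of
  \<open>(\<Sum>j. c j * r j)\<^sup>2\<close> and the squared norm of
  \<open>\<Sum>j. (c j * r j) *\<^sub>R v j\<close>, where \<open>r\<close> is the residual. The two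
  identities of \<open>john_decomposition\<close> evaluate these sums as \<open>z\<close> and
  \<open>- (A *v (x - z *\<^sub>R d))\<close>.\<close>

lemma sdp_feasible_scaled_mvie:
  fixes S :: "real^'k^'j" and B R :: "real^'k^'k"
  assumes opt: "mvie_optimal S t B d" and B: "pos_def B" and R: "B ** R = mat 1" "R ** B = mat 1"
    and symR: "symmetric_matrix R"
  defines "A \<equiv> (1 / real CARD('k)) *\<^sub>R R"
  shows "\<exists>N F g h. sdp_feasible S t A (- (A *v d)) N F g h"
proof -
  obtain \<theta> :: "'j \<Rightarrow> real" where \<theta>:
    "\<And>j. 0 \<le> \<theta> j" "sum \<theta> UNIV = 1"
    "\<And>j. \<theta> j \<noteq> 0 \<Longrightarrow> B *v row j S \<noteq> 0 \<and> norm (B *v row j S) + row j S \<bullet> d = t $ j"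
    "(\<Sum>j\<in>UNIV. (\<theta> j / norm (B *v row j S)) *\<^sub>R row j S) = 0"
    "(\<Sum>j\<in>UNIV. (\<theta> j / (norm (B *v row j S))\<^sup>2) *\<^sub>R outer (row j S) (row j S)) =
      (1 / real CARD('k)) *\<^sub>R (R ** R)"
    using john_decomposition[OF opt B R symR] by blast
  define n where "n j = norm (B *v row j S)" for j
  define v where "v j = (1 / n j) *\<^sub>R (B *v row j S)" for j
  \<comment> \<open>Where \<open>n j = 0\<close>, both \<open>v j\<close> and \<open>c j\<close> are
    0 by the convention for division. Such indices have \<open>\<theta> j = 0\<close>.\<close>
  define c where "c j = \<theta> j / n j" for j
  define N :: "real^'j^'j" where "N = (\<chi> i j. c i * c j * (1 - v i \<bullet> v j))"
  have c: "0 \<le> c j" for j using \<theta>(1) by (simp add: c_def n_def)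
  have v: "norm (v j) \<le> 1" for j by (simp add: v_def n_def)
  have "sdp_feasible S t A (- (A *v d)) N (A ** A) (A *v - (A *v d)) (- (A *v d) \<bullet> - (A *v d))"
  proof (rule sdp_feasible_gram)
    show "symmetric_matrix A" using symR by (simp add: A_def symmetric_matrix_scaleR)
    show "symmetric_matrix N"
      by (simp add: symmetric_matrix_def transpose_def N_def vec_eq_iff inner_commute mult.commute)
    show "0 \<le> N $ i $ j" for i j
    proof -
      have "v i \<bullet> v j \<le> norm (v i) * norm (v j)" by (rule norm_cauchy_schwarz)
      also have "\<dots> \<le> 1 * 1" using v by (intro mult_mono) auto
      finally show ?thesis using c by (simp add: N_def)
    qed
    fix x z
    define r where "r = z *\<^sub>R t - S *v x"
    define y where "y = x - z *\<^sub>R d"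
    \<comment> \<open>For a contact constraint \<open>t $ j - row j S \<bullet> d = n j\<close>, so
      the residual becomes \<open>z * n j - row j S \<bullet> y\<close>. The weight removes all
      other constraints.\<close>
    have cr: "c j * r $ j = \<theta> j * z - (\<theta> j / n j) * (row j S \<bullet> y)" for j
    proof (cases "\<theta> j = 0")
      case False
      then have n: "n j \<noteq> 0" and t: "t $ j = n j + row j S \<bullet> d"
        using \<theta>(3)[of j] by (auto simp: n_def)
      have "r $ j = z * t $ j - row j S \<bullet> x"
        by (simp add: r_def matrix_vector_mult_def inner_vec_def row_def)
      also have "\<dots> = z * n j - row j S \<bullet> y"
        by (simp add: t y_def inner_diff_right algebra_simps)
      finally show ?thesis using n by (simp add: c_def right_diff_distrib diff_divide_distrib)
    qed (simp add: c_def)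
    have s0: "(\<Sum>j\<in>UNIV. (\<theta> j / n j) * (row j S \<bullet> y)) = 0"
      using arg_cong[OF \<theta>(4), of "\<lambda>w. w \<bullet> y"] by (simp add: inner_sum_left n_def)
    have 1: "(\<Sum>j\<in>UNIV. c j * r $ j) = z"
      unfolding cr sum_subtractf s0 sum_distrib_right[symmetric] \<theta>(2) by simp
    have Bs: "(\<Sum>j\<in>UNIV. (\<theta> j / n j) *\<^sub>R (B *v row j S)) = 0"
      using arg_cong[OF \<theta>(4), of "\<lambda>w. B *v w"]
      by (simp add: linear_sum[OF matrix_vector_mul_linear] matrix_vector_mult_scaleR n_def)
    \<comment> \<open>The second-moment identity turns the sum into \<open>B ** R ** R\<close>
      divided by the dimension, and \<open>B ** R\<close> cancels.\<close>
    have M: "(\<Sum>j\<in>UNIV. (\<theta> j / (n j)\<^sup>2 * (row j S \<bullet> y)) *\<^sub>R (B *v row j S)) = A *v y"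
    proof -
      have "(\<Sum>j\<in>UNIV. (\<theta> j / (n j)\<^sup>2 * (row j S \<bullet> y)) *\<^sub>R (B *v row j S)) =
          B *v ((\<Sum>j\<in>UNIV. (\<theta> j / (n j)\<^sup>2) *\<^sub>R outer (row j S) (row j S)) *v y)"
        by (simp add: sum_matrix_vector_mult outer_mult_vector linear_sum[OF matrix_vector_mul_linear]
            matrix_vector_mult_scaleR flip: scaleR_matrix_vector_assoc)
      also have "\<dots> = (1 / real CARD('k)) *\<^sub>R (((B ** R) ** R) *v y)"
        unfolding n_def \<theta>(5)
        by (simp add: matrix_vector_mult_scaleR flip: scaleR_matrix_vector_assoc matrix_vector_mul_assoc)
      finally show ?thesis by (simp add: R A_def flip: scaleR_matrix_vector_assoc)
    qed
    have "(\<Sum>j\<in>UNIV. (c j * r $ j) *\<^sub>R v j) = (\<Sum>j\<in>UNIV. z *\<^sub>R ((\<theta> j / n j) *\<^sub>R (B *v row j S))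
        - (\<theta> j / (n j)\<^sup>2 * (row j S \<bullet> y)) *\<^sub>R (B *v row j S))"
      by (intro sum.cong) (simp_all add: cr v_def power2_eq_square scaleR_diff_left diff_divide_distrib mult_ac)
    also have "\<dots> = - (A *v y)"
      unfolding sum_subtractf scaleR_sum_right[symmetric] Bs M by simp
    finally have 2: "(\<Sum>j\<in>UNIV. (c j * r $ j) *\<^sub>R v j) = - (A *v y)" .
    have "r \<bullet> (N *v r) = (\<Sum>i\<in>UNIV. \<Sum>j\<in>UNIV. (c i * r $ i) * (c j * r $ j) * (1 - v i \<bullet> v j))"
      by (simp add: inner_vec_def matrix_vector_mult_def N_def sum_distrib_left mult_ac)
    \<comment> \<open>The 1 in \<open>1 - v i \<bullet> v j\<close> produces the square of the
      scalar sum, and the inner product produces the squared norm of the vector sum.\<close>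
    also have "\<dots> = (\<Sum>j\<in>UNIV. c j * r $ j)\<^sup>2
        - (\<Sum>j\<in>UNIV. (c j * r $ j) *\<^sub>R v j) \<bullet> (\<Sum>j\<in>UNIV. (c j * r $ j) *\<^sub>R v j)"
      unfolding power2_eq_square sum_product inner_sum_left inner_sum_right sum_subtractf[symmetric]
      by (intro sum.cong refl) (simp add: algebra_simps inner_commute)
    also have "\<dots> = z\<^sup>2 - (norm (A *v y))\<^sup>2" by (simp add: 1 2 dot_square_norm)
    also have "A *v y = A *v x + z *\<^sub>R - (A *v d)"
      by (simp add: y_def matrix_vector_mult_diff_distrib matrix_vector_mult_scaleR)
    finally show "(z *\<^sub>R t - S *v x) \<bullet> (N *v (z *\<^sub>R t - S *v x)) + (norm (A *v x + z *\<^sub>R - (A *v d)))\<^sup>2 \<le> z\<^sup>2"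
      by (simp add: r_def)
  qed
  then show ?thesis by blast
qed

section \<open>Comparison of the two volumes\<close>

theorem theorem3:
  fixes S :: "real^'k^'j" and t :: "real^'j"
    and A F B :: "real^'k^'k" and b g d :: "real^'k" and N :: "real^'j^'j" and h :: real
  assumes "compact {x. S *v x \<le> t}"
    and "interior {x. S *v x \<le> t} \<noteq> {}"
    and "sdp_optimal S t A b N F g h"
    and "mvie_optimal S t B d"
  shows "vol (ellipsoid A b) \<le> vol (scaled_mvie B d)"
proof -
  have B: "pos_def B" using mvie_optimal_pos_def[OF assms(2,4)] .
  then obtain R where R: "B ** R = mat 1" "R ** B = mat 1" "pos_def R" by (rule pos_def_inverse)
  define K where "K = real CARD('k)"
  have K: "0 < K" by (simp add: K_def)
  define A' where "A' = (1 / K) *\<^sub>R R"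
  have A': "pos_def A'" using R(3) K by (simp add: A'_def pos_def_scaleR)
  have "symmetric_matrix R" using R(3) by (simp add: pos_def_def)
  from sdp_feasible_scaled_mvie[OF assms(4) B R(1,2) this] have "- log_det A \<le> - log_det A'"
    using assms(3) unfolding sdp_optimal_def A'_def K_def by blast
  then have "log_det A' \<le> log_det A" by simp
  \<comment> \<open>\<open>log_det A'\<close> is finite, so the value \<open>- \<infinity>\<close>
    is excluded for \<open>A\<close>.\<close>
  then have A: "pos_def A" and "ln (det A') \<le> ln (det A)"
    using A' by (auto simp: log_det_def split: if_splits)
  then have le: "det A' \<le> det A" using pos_def_det_pos[OF A] pos_def_det_pos[OF A'] by simp
  \<comment> \<open>Since \<open>A'\<close> is the inverse of the scaled matrix, both volumes become
    reciprocals of determinants.\<close>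
  have "(K *\<^sub>R B) ** A' = mat 1"
    using K by (simp add: A'_def matrix_scalar_ac R flip: scalar_matrix_assoc)
  then have "det (K *\<^sub>R B) * det A' = 1" by (metis det_I det_mul)
  then have "det (K *\<^sub>R B) = 1 / det A'"
    using pos_def_det_pos[OF A'] by (simp add: field_simps)
  then have "vol (scaled_mvie B d) = 1 / det A'"
    using vol_scaled_mvie[OF B, of d] by (simp add: K_def)
  moreover have "vol (ellipsoid A b) = 1 / det A" using vol_ellipsoid[OF A] .
  ultimately show ?thesis using le pos_def_det_pos[OF A'] by (simp add: frac_le)
qed

end
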